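(* Let $d \geqslant 1$ and let $A \subset \mathbb{Z}^d$ be a nonempty finite set. Then $$|NA| = P_A(N) \quad \text{for all positive integers } N \geqslant \bigl(2\,|A|\cdot w(A)\bigr)^{(d+4)|A|}.$$
   Context: For a positive integer $N$, $NA := \{a_1 + \cdots + a_N : a_i \in A\}$ (repetitions allowed). By Khovanskii's theorem there is a (necessarily unique) polynomial $P_A(X) \in \mathbb{Q}[X]$, of degree at most $d$, such that $|NA| = P_A(N)$ for all sufficiently large integers $N$; $P_A$ denotes this polynomial. The width of $A$ is $w(A) := \max_{a_1,a_2 \in A} \|a_1 - a_2\|_\infty$. *)

theory Defs
  imports "HOL-Analysis.Analysis" "HOL-Computational_Algebra.Polynomial"
begin

definition iterated_sumset :: "nat \<Rightarrow> (int ^ 'd) set \<Rightarrow> (int ^ 'd) set" where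
  "iterated_sumset N A = {(\<Sum>i=1..N. a i) | a. \<forall>i\<in>{1..N}. a i \<in> A}"

(* The library's infnorm is only available on real Euclidean spaces. *)
definition linf_norm :: "int ^ 'd \<Rightarrow> int" where
  "linf_norm x = Max {\<bar>x $ i\<bar> | i. i \<in> UNIV}"

definition width :: "(int ^ 'd) set \<Rightarrow> int" where
  "width A = Max {linf_norm (a1 - a2) | a1 a2. a1 \<in> A \<and> a2 \<in> A}"

definition is_khovanskii_poly :: "(int ^ 'd) set \<Rightarrow> rat poly \<Rightarrow> bool" where
  "is_khovanskii_poly A p \<longleftrightarrow>
     degree p \<le> CARD('d) \<and>
     (\<exists>N0. \<forall>N\<ge>N0. of_nat (card (iterated_sumset N A)) = poly p (of_nat N))"

lemma is_khovanskii_poly_unique: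
  assumes "is_khovanskii_poly A p" "is_khovanskii_poly A q"
  shows "p = q"
proof -
  obtain M1 where M1: "\<forall>N\<ge>M1. of_nat (card (iterated_sumset N A)) = poly p (of_nat N)"
    using assms(1) by (auto simp: is_khovanskii_poly_def)
  obtain M2 where M2: "\<forall>N\<ge>M2. of_nat (card (iterated_sumset N A)) = poly q (of_nat N)"
    using assms(2) by (auto simp: is_khovanskii_poly_def)
  have "(of_nat :: nat \<Rightarrow> rat) ` {max M1 M2..} \<subseteq> {x. poly (p - q) x = 0}"
    using M1 M2 by fastforce
  moreover have "infinite ((of_nat :: nat \<Rightarrow> rat) ` {max M1 M2..})"
    by (simp add: finite_image_iff inj_on_def infinite_Ici)
  ultimately have "infinite {x. poly (p - q) x = 0}"
    using finite_subset by blast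
  then show "p = q"
    using poly_roots_finite[of "p - q"] by auto
qed

(* Existence for nonempty finite sets is Khovanskii's theorem. *)
definition khovanskii_poly :: "(int ^ 'd) set \<Rightarrow> rat poly" where
  "khovanskii_poly A = (THE p. is_khovanskii_poly A p)"

end

theory Submission
  imports Defs "HOL-Library.Fun_Lexorder"
begin

text \<open>
Write $A = \{a_0, \dots, a_{n-1}\}$. An element of $NA$ is $\sum_i x_i a_i$ for some vector
$x \in \mathbb{N}^n$ of total $N$, so $|NA|$ is the number of vectors of total $N$ after one
representative of every sum has been chosen. The representative is the lexicographically least one;
every other vector is called superfluous. Since the lexicographic order is compatible with addition,
the superfluous vectors form an up-set for the componentwise order, and the minimal elements of
this up-set decide everything.

The point is an explicit bound for these minimal elements (\<open>superfluous_descent\<close>). Let $x$ be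
superfluous because of $y$, so that $y$ is smaller and has the same total and the same sum, and let
$L > 0$ be one of the entries of $x$. For $0 \le j < L$ round the rational pair $(j x / L, j y / L)$ down to an integer
pair $(u_j, v_j)$. The sums of $u_j$ and $v_j$ would agree without the rounding, so they differ only
by a vector with entries at most $n w(A)$ in absolute value, where the $a_i$ are taken
relative to $a_0$; their totals differ by at most $n$. If $w(A) \ge 1$ and $L$
exceeds the number $M = (2 n w(A) + 1)^{d+1}$ of integer points in a box containing all these
differences, two indices
$j < l$ give the same value, and then $(s, t) = (u_l - u_j, v_l - v_j)$ and $(x - s, y - t)$ are
two pairs with equal sums and totals that add up to $(x, y)$. As $y$ precedes $x$, one of the
two pairs must be in the same order, so $s$ or $x - s$ is superfluous. Both are below $x$, and neither
is $x$ because at the position of the entry $L$ of $x$ the vector $s$ has the entry $l - j$, which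
 lies strictly between $0$ and $L$. Hence minimal superfluous vectors have all entries at most
$M$, and whether a vector is superfluous can be read off from its truncation, in
which every entry above $M$ is replaced by $M$ (\<open>superfluous_iff_truncation\<close>).

The number of vectors of total $N$ in a set that is determined by truncation at $M$ is a polynomial in
$N$ for $N > nM$ (\<open>card_compositions_polynomial\<close>), by induction on $n$: the last
coordinate is one of $0, \dots, M - 1$, or it is at least $M$, and the latter case contributes the
sum of a single counting function over all totals up to $N - M$. The polynomial has
degree at most $d$ because $NA$ lies in a box with side $O(N)$. For $n \ge 2$ the threshold $nM$ is below
$(2 n w(A))^{(d+4) n}$; for a singleton the count is always $1$.
\<close>

section \<open>Summation of polynomials\<close>

text \<open>
The difference of $X^{m+1}/(m+1)$ is $X^m$ plus lower powers, by the binomial theorem, and the lower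
powers are differences by induction.
\<close>

lemma power_as_difference:
  "\<exists>q. \<forall>x. poly q (x + 1) - poly q x = (x :: rat) ^ m"
proof (induction m rule: less_induct)
  case (less m)
  then have "\<forall>k\<in>{..<m}. \<exists>q. \<forall>x. poly q (x + 1) - poly q x = (x :: rat) ^ k"
    by simp
  from bchoice[OF this] obtain Q
    where Q: "\<forall>k\<in>{..<m}. \<forall>x. poly (Q k) (x + 1) - poly (Q k) x = (x :: rat) ^ k"
    by blast
  define q where "q = smult (1 / of_nat (Suc m))
    (monom 1 (Suc m) - (\<Sum>k<m. smult (of_nat (Suc m choose k)) (Q k)))"
  have "poly q (x + 1) - poly q x = x ^ m" for x
  proof -
    have "(x + 1) ^ Suc m = (\<Sum>k\<le>Suc m. of_nat (Suc m choose k) * x ^ k)"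
      by (simp only: binomial_ring) simp
    also have "\<dots> = (\<Sum>k<m. of_nat (Suc m choose k) * x ^ k) + of_nat (Suc m) * x ^ m + x ^ Suc m"
      by (simp only: lessThan_Suc_atMost[symmetric] sum.lessThan_Suc) simp
    finally have "(x + 1) ^ Suc m - x ^ Suc m
        - (\<Sum>k<m. of_nat (Suc m choose k) * (poly (Q k) (x + 1) - poly (Q k) x))
        = of_nat (Suc m) * x ^ m"
      using Q by simp
    moreover have "poly q (x + 1) - poly q x = ((x + 1) ^ Suc m - x ^ Suc m
        - (\<Sum>k<m. of_nat (Suc m choose k) * (poly (Q k) (x + 1) - poly (Q k) x))) / of_nat (Suc m)"
      by (simp only: q_def poly_smult poly_diff poly_sum poly_monom right_diff_distrib
          sum_subtractf diff_divide_distrib) simp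
    ultimately show ?thesis
      by (simp only: nonzero_mult_div_cancel_left of_nat_neq_0 not_False_eq_True)
  qed
  then show ?case by blast
qed

lemma polynomial_as_difference:
  "\<exists>q. \<forall>x. poly q (x + 1) - poly q x = poly p (x :: rat)"
proof -
  obtain Q where Q: "\<And>m x. poly (Q m) (x + 1) - poly (Q m) x = (x :: rat) ^ m"
    using power_as_difference by metis
  define q where "q = (\<Sum>i\<le>degree p. smult (coeff p i) (Q i))"
  have "poly q (x + 1) - poly q x = poly p x" for x
    by (simp add: q_def poly_sum sum_subtractf[symmetric] right_diff_distrib[symmetric] Q)
      (simp add: poly_altdef)
  then show ?thesis by blast
qed

lemma sum_eventually_polynomial:
  fixes f :: "nat \<Rightarrow> rat"
  assumes "\<And>r. r > T \<Longrightarrow> f r = poly p (of_nat r)"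
  shows "\<exists>q. \<forall>m\<ge>T. (\<Sum>r\<le>m. f r) = poly q (of_nat m)"
proof -
  obtain g where g: "\<And>x. poly g (x + 1) - poly g x = poly p x"
    using polynomial_as_difference by blast
  define q where "q = pcompose g [:1, 1:] + [:(\<Sum>r\<le>T. f r) - poly g (of_nat T + 1):]"
  have q: "poly q x = poly g (x + 1) + ((\<Sum>r\<le>T. f r) - poly g (of_nat T + 1))" for x
    by (simp add: q_def poly_pcompose add.commute)
  have "(\<Sum>r\<le>m. f r) = poly q (of_nat m)" if "m \<ge> T" for m
    using that
  proof (induction m rule: dec_induct)
    case base
    then show ?case by (simp add: q)
  next
    case (step m)
    then show ?case
      using g[of "of_nat m + 1"] assms[of "Suc m"] by (simp add: q algebra_simps)
  qed
  then show ?thesis by blast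
qed

section \<open>Counting vectors of given total\<close>

text \<open>
Vectors of length $n$ are functions on the natural numbers that vanish from $n$ on, so that vectors of
different lengths live in one type and the induction on $n$ appends a coordinate by a function
update.
\<close>

definition compositions :: "nat \<Rightarrow> nat \<Rightarrow> (nat \<Rightarrow> nat) set" where
  "compositions n N = {x. (\<forall>i\<ge>n. x i = 0) \<and> (\<Sum>i<n. x i) = N}"

lemma finite_compositions: "finite (compositions n N)"
proof (rule finite_subset)
  have "x i \<le> N" if "x \<in> compositions n N" "i < n" for x i
    using that member_le_sum[of i "{..<n}" x] by (auto simp: compositions_def)
  then show "compositions n N \<subseteq> {x. \<forall>i. (i \<in> {..<n} \<longrightarrow> x i \<in> {..N}) \<and> (i \<notin> {..<n} \<longrightarrow> x i = 0)}"
    by (auto simp: compositions_def)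
  show "finite {x. \<forall>i. (i \<in> {..<n} \<longrightarrow> x i \<in> {..N}) \<and> (i \<notin> {..<n} \<longrightarrow> x i = 0)}"
    by (rule finite_set_of_finite_funs) auto
qed

lemma card_compositions_Suc:
  "card {x \<in> compositions (Suc n) N. P x}
     = (\<Sum>t\<le>N. card {x \<in> compositions n (N - t). P (x(n := t))})"
proof -
  let ?C = "\<lambda>t. {x \<in> compositions n (N - t). P (x(n := t))}"
  have sum_upd: "sum (x(n := t)) {..<n} = sum x {..<n}" for x :: "nat \<Rightarrow> nat" and t
    by (rule sum.cong) auto
  have "bij_betw (\<lambda>(t, x). x(n := t)) (SIGMA t:{..N}. ?C t) {x \<in> compositions (Suc n) N. P x}"
  proof (rule bij_betw_byWitness[where f' = "\<lambda>x. (x n, x(n := 0))"])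
    show "\<forall>p\<in>SIGMA t:{..N}. ?C t. (\<lambda>x. (x n, x(n := 0))) ((\<lambda>(t, x). x(n := t)) p) = p"
    proof
      fix p assume "p \<in> (SIGMA t:{..N}. ?C t)"
      then obtain t x where p: "p = (t, x)" "x n = 0"
        by (auto simp: compositions_def)
      then have "x(n := 0) = x"
        by (metis fun_upd_triv)
      with p show "(\<lambda>x. (x n, x(n := 0))) ((\<lambda>(t, x). x(n := t)) p) = p"
        by simp
    qed
    show "\<forall>x\<in>{x \<in> compositions (Suc n) N. P x}. (\<lambda>(t, x). x(n := t)) (x n, x(n := 0)) = x"
      by simp
    show "(\<lambda>(t, x). x(n := t)) ` (SIGMA t:{..N}. ?C t) \<subseteq> {x \<in> compositions (Suc n) N. P x}"
    proof (rule image_subsetI)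
      fix p assume "p \<in> (SIGMA t:{..N}. ?C t)"
      then obtain t x where p: "p = (t, x)"
        and "t \<le> N" "x \<in> compositions n (N - t)" "P (x(n := t))"
        by blast
      moreover have "sum (x(n := t)) {..<Suc n} = sum x {..<n} + t"
        by (simp only: sum.lessThan_Suc sum_upd fun_upd_same)
      ultimately have "x(n := t) \<in> compositions (Suc n) N" "P (x(n := t))"
        by (simp_all only: compositions_def mem_Collect_eq) simp
      with p show "(\<lambda>(t, x). x(n := t)) p \<in> {x \<in> compositions (Suc n) N. P x}"
        by simp
    qed
    show "(\<lambda>x. (x n, x(n := 0))) ` {x \<in> compositions (Suc n) N. P x} \<subseteq> (SIGMA t:{..N}. ?C t)"
    proof (rule image_subsetI)
      fix x assume x: "x \<in> {x \<in> compositions (Suc n) N. P x}"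
      then have sum: "sum x {..<n} + x n = N"
        by (simp add: compositions_def)
      have "(x(n := 0)) i = 0" if "i \<ge> n" for i
        using x that by (cases "i = n") (auto simp: compositions_def)
      then have "x(n := 0) \<in> compositions n (N - x n)"
        unfolding compositions_def mem_Collect_eq sum_upd using sum by auto
      with x sum show "(x n, x(n := 0)) \<in> (SIGMA t:{..N}. ?C t)"
        by auto
    qed
  qed
  then have "card {x \<in> compositions (Suc n) N. P x} = card (SIGMA t:{..N}. ?C t)"
    by (simp add: bij_betw_same_card)
  also have "\<dots> = (\<Sum>t\<le>N. card (?C t))"
    by (rule card_SigmaI) (auto intro: finite_subset[OF _ finite_compositions])
  finally show ?thesis .
qed

text \<open>
The induction splits off the last coordinate $t$. Each $t < M$ contributes a shift of a counting
function of length $n$; all $t \ge M$ share one such function, whose sum up to $N - M$ is polynomial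
by summation. The threshold grows by $M$ in each step because of the shifts. It starts with
$N > 0$, as the empty vector has total $0$.
\<close>

lemma card_compositions_polynomial:
  assumes "\<And>x. (\<forall>i\<ge>n. x i = 0) \<Longrightarrow> P x \<longleftrightarrow> P (\<lambda>i. min (x i) M)"
  shows "\<exists>p :: rat poly. \<forall>N > n * M.
    of_nat (card {x \<in> compositions n N. P x}) = poly p (of_nat N)"
  using assms
proof (induction n arbitrary: P)
  case 0
  have "of_nat (card {x \<in> compositions 0 N. P x}) = poly (0 :: rat poly) (of_nat N)"
    if "N > 0 * M" for N
    using that by (simp add: compositions_def)
  then show ?case by blast
next
  case (Suc n)
  define F where "F t r = (of_nat (card {x \<in> compositions n r. P (x(n := t))}) :: rat)" for t r
  have trunc: "P (x(n := t)) \<longleftrightarrow> P ((\<lambda>i. min (x i) M)(n := min t M))"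
    if "\<forall>i\<ge>n. x i = 0" for x t
  proof -
    have "(\<lambda>i. min ((x(n := t)) i) M) = (\<lambda>i. min (x i) M)(n := min t M)"
      by auto
    moreover have "\<forall>i\<ge>Suc n. (x(n := t)) i = 0"
      using that by simp
    ultimately show ?thesis
      using Suc.prems[of "x(n := t)"] by (simp only:)
  qed
  have F_ge: "F t r = F M r" if "t \<ge> M" for t r
  proof -
    have "P (x(n := t)) \<longleftrightarrow> P (x(n := M))" if "x \<in> compositions n r" for x
      using trunc[of x t] trunc[of x M] that \<open>t \<ge> M\<close> by (simp add: compositions_def)
    then show ?thesis
      unfolding F_def by (metis (mono_tags, lifting) Collect_cong)
  qed
  have "\<exists>p. \<forall>r > n * M. F t r = poly p (of_nat r)" for t
    unfolding F_def
  proof (rule Suc.IH)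
    fix x :: "nat \<Rightarrow> nat"
    assume x: "\<forall>i\<ge>n. x i = 0"
    show "P (x(n := t)) \<longleftrightarrow> P ((\<lambda>i. min (x i) M)(n := t))"
      using trunc[OF x, of t] trunc[of "\<lambda>i. min (x i) M" t] x by simp
  qed
  then obtain p where p: "\<And>t r. r > n * M \<Longrightarrow> F t r = poly (p t) (of_nat r)"
    by metis
  obtain q where q: "\<And>m. m \<ge> n * M \<Longrightarrow> (\<Sum>r\<le>m. F M r) = poly q (of_nat m)"
    using sum_eventually_polynomial[of "n * M" "F M" "p M"] p by blast
  define g where "g = (\<Sum>t<M. pcompose (p t) [:- of_nat t, 1:]) + pcompose q [:- of_nat M, 1:]"
  have "of_nat (card {x \<in> compositions (Suc n) N. P x}) = poly g (of_nat N)"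
    if N: "N > Suc n * M" for N
  proof -
    have "of_nat (card {x \<in> compositions (Suc n) N. P x}) = (\<Sum>t\<le>N. F t (N - t))"
      by (simp add: card_compositions_Suc F_def)
    also have "{..N} = {..<M} \<union> {M..N}"
      using N by auto
    also have "(\<Sum>t\<in>{..<M} \<union> {M..N}. F t (N - t))
        = (\<Sum>t<M. F t (N - t)) + (\<Sum>t=M..N. F t (N - t))"
      by (rule sum.union_disjoint) auto
    also have "(\<Sum>t=M..N. F t (N - t)) = (\<Sum>t=M..N. F M (N - t))"
      by (rule sum.cong) (auto intro: F_ge)
    also have "\<dots> = (\<Sum>r\<le>N - M. F M r)"
      by (rule sum.reindex_bij_witness[of _ "\<lambda>r. N - r" "\<lambda>t. N - t"])
        (use N in auto)
    also have "\<dots> = poly q (of_nat (N - M))"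
      by (rule q) (use N in auto)
    also have "(\<Sum>t<M. F t (N - t)) = (\<Sum>t<M. poly (p t) (of_nat (N - t)))"
    proof (rule sum.cong)
      fix t assume "t \<in> {..<M}"
      then have "N - t > n * M"
        using N by simp
      then show "F t (N - t) = poly (p t) (of_nat (N - t))"
        by (rule p)
    qed simp
    also have "\<dots> + poly q (of_nat (N - M)) = poly g (of_nat N)"
      using N by (auto simp: g_def poly_sum poly_pcompose of_nat_diff intro!: sum.cong)
    finally show ?thesis .
  qed
  then show ?case by blast
qed

section \<open>Superfluous vectors\<close>

lemma less_fun_add_right:
  fixes f g h :: "nat \<Rightarrow> nat"
  assumes "less_fun f g"
  shows "less_fun (\<lambda>i. f i + h i) (\<lambda>i. g i + h i)"
  using assms by (auto simp: less_fun_def)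

text \<open>
A sum of two pairs in the weak reverse order would again be in the weak reverse order. This is what
passes superfluity from a vector to one of its two parts.
\<close>

lemma less_fun_of_sum:
  fixes f g f' g' :: "nat \<Rightarrow> nat"
  assumes "less_fun (\<lambda>i. f i + f' i) (\<lambda>i. g i + g' i)"
    and "finite {i. f i \<noteq> g i}" and "finite {i. f' i \<noteq> g' i}"
  shows "less_fun f g \<or> less_fun f' g'"
proof (rule ccontr)
  assume "\<not> (less_fun f g \<or> less_fun f' g')"
  then have "less_fun g f \<or> f = g" "less_fun g' f' \<or> f' = g'"
    using less_fun_trichotomy assms(2,3) by blast+
  then have "less_fun (\<lambda>i. g i + g' i) (\<lambda>i. f i + g' i) \<or> f = g"
    "less_fun (\<lambda>i. f i + g' i) (\<lambda>i. f i + f' i) \<or> f' = g'"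
    using less_fun_add_right[of g f g'] less_fun_add_right[of g' f' f]
    by (auto simp: add.commute)
  then have "less_fun (\<lambda>i. g i + g' i) (\<lambda>i. f i + f' i)
      \<or> (\<lambda>i. g i + g' i) = (\<lambda>i. f i + f' i)"
    using less_fun_trans by blast
  then show False
    using assms(1) less_fun_asym less_fun_irrefl by metis
qed

text \<open>
The constraints that two representations of the same element satisfy, namely equal totals and equal
coordinates of the sums, are all of the form ``equal value of an integral linear form''. Treating
them as one family indexed by \<open>'k\<close> lets the box argument be carried out once for
all of them.
\<close>

definition weight :: "('k \<Rightarrow> nat \<Rightarrow> int) \<Rightarrow> nat \<Rightarrow> (nat \<Rightarrow> nat) \<Rightarrow> 'k \<Rightarrow> int" where
  "weight c n x k = (\<Sum>i<n. int (x i) * c k i)"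

definition superfluous :: "('k \<Rightarrow> nat \<Rightarrow> int) \<Rightarrow> nat \<Rightarrow> (nat \<Rightarrow> nat) \<Rightarrow> bool" where
  "superfluous c n x \<longleftrightarrow>
     (\<exists>y. (\<forall>i\<ge>n. y i = 0) \<and> less_fun y x \<and> weight c n y = weight c n x)"

lemma weight_add: "weight c n (\<lambda>i. x i + y i) k = weight c n x k + weight c n y k"
  by (simp add: weight_def algebra_simps sum.distrib)

lemma weight_diff:
  assumes "\<And>i. y i \<le> x i"
  shows "weight c n (\<lambda>i. x i - y i) k = weight c n x k - weight c n y k"
  using assms by (simp add: weight_def of_nat_diff algebra_simps sum_subtractf)

lemma superfluous_mono:
  assumes "superfluous c n x" and "\<And>i. x i \<le> z i" and "\<forall>i\<ge>n. z i = 0"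
  shows "superfluous c n z"
proof -
  obtain y where y: "\<forall>i\<ge>n. y i = 0" "less_fun y x" "weight c n y = weight c n x"
    using assms(1) by (auto simp: superfluous_def)
  let ?y = "\<lambda>i. y i + (z i - x i)"
  have z: "(\<lambda>i. x i + (z i - x i)) = z"
    using assms(2) by auto
  have "less_fun ?y z"
    using less_fun_add_right[OF y(2), of "\<lambda>i. z i - x i"] z by simp
  moreover have "weight c n ?y = weight c n z"
    using y(3) weight_add[of c n x "\<lambda>i. z i - x i"] z by (simp add: fun_eq_iff weight_add)
  moreover have "\<forall>i\<ge>n. ?y i = 0"
    using y(1) assms(3) by simp
  ultimately show ?thesis
    unfolding superfluous_def by (intro exI[of _ ?y] conjI)
qed

text \<open>
Scaling $x$ and $y$ by $j/L$ preserves the equality of weights, so the difference is caused by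
rounding down alone. In each coordinate the two rounding errors lie in $[0,1)$ and partly cancel, hence
they count once and not twice.
\<close>

lemma weight_scaled_difference_bound:
  assumes "weight c n x k = weight c n y k" and "\<And>i. i < n \<Longrightarrow> \<bar>c k i\<bar> \<le> int W" and "L > 0"
  shows "\<bar>weight c n (\<lambda>i. j * x i div L) k - weight c n (\<lambda>i. j * y i div L) k\<bar> \<le> int (n * W)"
    (is "\<bar>?D\<bar> \<le> _")
proof -
  let ?r = "\<lambda>x i. int (j * x i mod L)"
  have L: "int L * int (j * x i div L) = int j * int (x i) - ?r x i" for x :: "nat \<Rightarrow> nat" and i
  proof -
    have "int L * int (j * x i div L) + ?r x i = int (j * x i)"
      by (simp only: of_nat_mult[symmetric] of_nat_add[symmetric] mult_div_mod_eq)
    then show ?thesis by simp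
  qed
  have scaled: "int L * weight c n (\<lambda>i. j * x i div L) k
      = int j * weight c n x k - (\<Sum>i<n. ?r x i * c k i)" for x
    by (simp only: weight_def sum_distrib_left mult.assoc[symmetric] L left_diff_distrib
        sum_subtractf)
  have D: "int L * ?D = (\<Sum>i<n. (?r y i - ?r x i) * c k i)"
    using assms(1) scaled[of x] scaled[of y]
    by (simp add: right_diff_distrib left_diff_distrib sum_subtractf)
  have "int L * \<bar>?D\<bar> = \<bar>int L * ?D\<bar>"
    by (simp only: abs_mult abs_of_nat)
  also have "\<dots> = \<bar>\<Sum>i<n. (?r y i - ?r x i) * c k i\<bar>"
    by (simp only: D)
  also have "\<dots> \<le> (\<Sum>i<n. \<bar>(?r y i - ?r x i) * c k i\<bar>)"
    by (rule sum_abs)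
  also have "\<dots> \<le> (\<Sum>i<n. int L * int W)"
  proof (rule sum_mono)
    fix i assume "i \<in> {..<n}"
    have "?r y i < int L" "?r x i < int L" "0 \<le> ?r y i" "0 \<le> ?r x i"
      using assms(3) by simp_all
    then have "\<bar>?r y i - ?r x i\<bar> \<le> int L"
      by linarith
    then show "\<bar>(?r y i - ?r x i) * c k i\<bar> \<le> int L * int W"
      unfolding abs_mult using assms(2) \<open>i \<in> {..<n}\<close> by (intro mult_mono) auto
  qed
  also have "\<dots> = int L * int (n * W)"
    by simp
  finally show ?thesis
    using assms(3) by simp
qed

text \<open>
A large entry leaves room for many rounded scalings, and two of them with the same weight difference
split $(x, y)$ into two pairs of equal weight, one of which inherits the lexicographic order.
\<close>

lemma superfluous_descent:
  fixes c :: "'k::finite \<Rightarrow> nat \<Rightarrow> int"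
  assumes "superfluous c n x" and supp: "\<forall>i\<ge>n. x i = 0"
    and c: "\<And>k i. i < n \<Longrightarrow> \<bar>c k i\<bar> \<le> int W"
    and big: "x i0 > (2 * (n * W) + 1) ^ CARD('k)"
  shows "\<exists>s. superfluous c n s \<and> (\<forall>i. s i \<le> x i) \<and> s \<noteq> x"
proof -
  obtain y where y: "\<forall>i\<ge>n. y i = 0" "less_fun y x" "weight c n y = weight c n x"
    using assms(1) by (auto simp: superfluous_def)
  \<comment> \<open>Scaling by the reciprocal of the entry at \<open>i0\<close> makes that entry run through
    $0, 1, 2, \dots$ without rounding, so that different scalings are really different.\<close>
  define L where "L = x i0"
  define u where "u j i = j * x i div L" for j i
  define v where "v j i = j * y i div L" for j i
  define h where "h j = (\<lambda>k. weight c n (u j) k - weight c n (v j) k)" for j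
  have L: "L > 0"
    using big by (simp add: L_def)
  let ?B = "UNIV \<rightarrow>\<^sub>E {- int (n * W)..int (n * W)} :: ('k \<Rightarrow> int) set"
  have "h ` {..<L} \<subseteq> ?B"
  proof (clarsimp simp: PiE_iff)
    fix j k
    have "\<bar>h j k\<bar> \<le> int (n * W)"
      unfolding h_def u_def v_def
      using weight_scaled_difference_bound[of c n x k y W L j] y(3) c L by simp
    then show "- (int n * int W) \<le> h j k \<and> h j k \<le> int n * int W"
      by (simp add: abs_le_iff)
  qed
  moreover have "card ?B = (2 * (n * W) + 1) ^ CARD('k)"
    by (simp add: card_funcsetE nat_add_distrib nat_mult_distrib mult.commute)
  moreover have "finite ?B"
    by (rule finite_PiE) auto
  ultimately have "card (h ` {..<L}) < card {..<L}"
    using big card_mono[of ?B "h ` {..<L}"] by (simp add: L_def)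
  then have "\<not> inj_on h {..<L}"
    by (rule pigeonhole)
  then obtain j l where jl: "j < l" "l < L" "h j = h l"
    unfolding inj_on_def by (metis lessThan_iff linorder_neqE_nat)
  define s where "s i = u l i - u j i" for i
  define t where "t i = v l i - v j i" for i
  have mono: "u j i \<le> u l i" "v j i \<le> v l i" for i
    using jl(1) by (auto simp: u_def v_def intro!: div_le_mono mult_le_mono1)
  have "u l i \<le> x i" "v l i \<le> y i" for i
  proof -
    have "l * z div L \<le> z" for z
      using div_le_mono[of "l * z" "L * z" L] jl(2) L by (simp add: mult_le_mono1)
    then show "u l i \<le> x i" "v l i \<le> y i"
      by (auto simp: u_def v_def)
  qed
  then have le: "s i \<le> x i" "t i \<le> y i" for i
    by (auto simp: s_def t_def intro: le_trans diff_le_self)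
  have ws: "weight c n t = weight c n s"
  proof
    fix k
    have "h j k = h l k" using jl(3) by simp
    moreover have "weight c n s k = weight c n (u l) k - weight c n (u j) k"
      "weight c n t k = weight c n (v l) k - weight c n (v j) k"
      unfolding s_def t_def using mono by (auto intro: weight_diff)
    ultimately show "weight c n t k = weight c n s k"
      by (simp add: h_def)
  qed
  have wd: "weight c n (\<lambda>i. y i - t i) = weight c n (\<lambda>i. x i - s i)"
    using le y(3) ws by (simp add: fun_eq_iff weight_diff)
  have "s i0 = l - j"
    using L by (simp add: s_def u_def L_def)
  then have s_i0: "0 < s i0" "s i0 < x i0"
    using jl by (auto simp: L_def)
  have supp': "\<forall>i\<ge>n. t i = 0" "\<forall>i\<ge>n. s i = 0"
    using le y(1) supp by (metis le_zero_eq)+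
  have fin: "finite {i. f i \<noteq> g i}" if "\<forall>i\<ge>n. f i = 0" "\<forall>i\<ge>n. g i = 0"
    for f g :: "nat \<Rightarrow> nat"
    by (rule finite_subset[of _ "{..<n}"]) (use that in \<open>auto simp: not_le[symmetric]\<close>)
  have "(\<lambda>i. t i + (y i - t i)) = y" "(\<lambda>i. s i + (x i - s i)) = x"
    using le by auto
  then have "less_fun (\<lambda>i. t i + (y i - t i)) (\<lambda>i. s i + (x i - s i))"
    using y(2) by simp
  then have "less_fun t s \<or> less_fun (\<lambda>i. y i - t i) (\<lambda>i. x i - s i)"
    by (rule less_fun_of_sum) (use fin supp' y(1) supp in auto)
  then show ?thesis
  proof
    assume "less_fun t s"
    then have "superfluous c n s"
      unfolding superfluous_def using supp' ws by blast
    moreover have "s \<noteq> x"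
      using s_i0(2) by auto
    ultimately show ?thesis
      using le(1) by blast
  next
    assume "less_fun (\<lambda>i. y i - t i) (\<lambda>i. x i - s i)"
    then have "superfluous c n (\<lambda>i. x i - s i)"
      unfolding superfluous_def using y(1) wd by (intro exI[of _ "\<lambda>i. y i - t i"]) auto
    moreover have "(\<lambda>i. x i - s i) \<noteq> x"
      using s_i0 by (metis diff_less less_irrefl less_trans)
    ultimately show ?thesis
      by (intro exI[of _ "\<lambda>i. x i - s i"]) auto
  qed
qed

lemma superfluous_has_small_witness:
  fixes c :: "'k::finite \<Rightarrow> nat \<Rightarrow> int"
  assumes "superfluous c n x" and "\<forall>i\<ge>n. x i = 0"
    and c: "\<And>k i. i < n \<Longrightarrow> \<bar>c k i\<bar> \<le> int W"
  shows "\<exists>s. superfluous c n s \<and> (\<forall>i. s i \<le> x i \<and> s i \<le> (2 * (n * W) + 1) ^ CARD('k))"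
  using assms(1,2)
proof (induction "\<Sum>i<n. x i" arbitrary: x rule: less_induct)
  case less
  show ?case
  proof (cases "\<exists>i. x i > (2 * (n * W) + 1) ^ CARD('k)")
    case True
    then obtain s where s: "superfluous c n s" "\<And>i. s i \<le> x i" "s \<noteq> x"
      using superfluous_descent[OF less.prems c] by blast
    have supp: "\<forall>i\<ge>n. s i = 0"
      using s(2) less.prems(2) by (metis le_zero_eq)
    obtain i where "s i \<noteq> x i"
      using s(3) by auto
    then have "i < n" "s i < x i"
      using s(2)[of i] supp less.prems(2) by (auto simp: not_le[symmetric])
    then have "(\<Sum>i<n. s i) < (\<Sum>i<n. x i)"
      using s(2) by (intro sum_strict_mono_ex1) auto
    from less.hyps[OF this s(1) supp] s(2) show ?thesis
      by (meson le_trans)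
  next
    case False
    then show ?thesis
      using less.prems by (auto simp: not_less)
  qed
qed

text \<open>
A small superfluous vector below $x$ is also below the truncation of $x$.
\<close>

lemma superfluous_iff_truncation:
  fixes c :: "'k::finite \<Rightarrow> nat \<Rightarrow> int"
  assumes "\<forall>i\<ge>n. x i = 0" and "\<And>k i. i < n \<Longrightarrow> \<bar>c k i\<bar> \<le> int W"
  shows "superfluous c n x \<longleftrightarrow> superfluous c n (\<lambda>i. min (x i) ((2 * (n * W) + 1) ^ CARD('k)))"
proof
  assume "superfluous c n x"
  from superfluous_has_small_witness[OF this assms]
  show "superfluous c n (\<lambda>i. min (x i) ((2 * (n * W) + 1) ^ CARD('k)))"
    using assms(1) by (auto intro: superfluous_mono)
next
  assume "superfluous c n (\<lambda>i. min (x i) ((2 * (n * W) + 1) ^ CARD('k)))"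
  then show "superfluous c n x"
    by (rule superfluous_mono) (use assms(1) in auto)
qed

section \<open>Degree of the counting polynomial\<close>

lemma degree_le_of_polynomial_growth:
  fixes p :: "rat poly"
  assumes "\<And>N :: nat. N > T \<Longrightarrow> 0 \<le> poly p (of_nat N)"
    and "\<And>N :: nat. N > T \<Longrightarrow> poly p (of_nat N) \<le> (of_nat (2 * (C * N) + 1)) ^ d"
  shows "degree p \<le> d"
proof (rule ccontr)
  assume deg: "\<not> degree p \<le> d"
  define P where "P = map_poly real_of_rat p"
  have degP: "degree P = degree p"
    unfolding P_def by (rule degree_map_poly) simp
  have P: "poly P (real N) = real_of_rat (poly p (of_nat N))" for N
    by (simp add: P_def poly_altdef degP[unfolded P_def] coeff_map_poly of_rat_sum
        of_rat_mult of_rat_power)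
  define B where "B = [:1, 2 * real C:] ^ d"
  have B: "poly B (real N) = real_of_rat (of_nat (2 * (C * N) + 1) ^ d)" for N
    by (simp add: B_def of_rat_power of_rat_add of_rat_mult algebra_simps)
  have P_bounds: "0 \<le> poly P (real N)" "poly P (real N) \<le> poly B (real N)" if "N > T" for N
    unfolding P B of_rat_less_eq using assms[OF that] by simp_all
  have "degree B \<le> d"
    unfolding B_def using degree_power_le[of "[:1, 2 * real C:]" d] by (simp split: if_splits)
  then have degB: "degree (- B) < degree P"
    using deg degP by simp
  \<comment> \<open>A polynomial with positive leading coefficient is eventually positive. This is
    applied to $P - B$ or to $-P$, according to the sign of the leading coefficient of $P$.\<close>
  have no_lower: False if "lead_coeff Q > 0" "\<And>N. N > T \<Longrightarrow> poly Q (real N) \<le> 0" for Q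
  proof -
    obtain b where b: "\<forall>x\<ge>b. lead_coeff Q \<le> poly Q x"
      using poly_pinfty_gt_lc[OF \<open>lead_coeff Q > 0\<close>] by blast
    obtain N where "real N > max b (real T)"
      using reals_Archimedean2 by blast
    with b that show False
      by (metis le_less_trans less_le_not_le max_less_iff_conj of_nat_less_iff order_less_imp_le)
  qed
  have "P \<noteq> 0"
    using deg degP by auto
  then consider "lead_coeff P > 0" | "lead_coeff P < 0"
    using leading_coeff_neq_0[of P] by linarith
  then show False
  proof cases
    case 1
    have "lead_coeff (- B + P) = lead_coeff P"
      by (rule lead_coeff_add_le[OF degB])
    then show False
      using no_lower[of "- B + P"] 1 P_bounds by auto
  next
    case 2
    then show False
      using no_lower[of "- P"] P_bounds by (auto simp: lead_coeff_minus)
  qed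
qed

lemma iterated_sumset_0: "iterated_sumset 0 A = {0}"
  by (auto simp: iterated_sumset_def)

lemma iterated_sumset_Suc:
  "iterated_sumset (Suc N) A = {s + b | s b. s \<in> iterated_sumset N A \<and> b \<in> A}"
proof (intro equalityI subsetI)
  fix v assume "v \<in> iterated_sumset (Suc N) A"
  then obtain a where a: "v = (\<Sum>i=1..Suc N. a i)" "\<forall>i\<in>{1..Suc N}. a i \<in> A"
    by (auto simp: iterated_sumset_def)
  have "(\<Sum>i=1..N. a i) \<in> iterated_sumset N A"
    unfolding iterated_sumset_def using a(2) by auto
  moreover have "v = (\<Sum>i=1..N. a i) + a (Suc N)" "a (Suc N) \<in> A"
    using a by auto
  ultimately show "v \<in> {s + b | s b. s \<in> iterated_sumset N A \<and> b \<in> A}"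
    by blast
next
  fix v assume "v \<in> {s + b | s b. s \<in> iterated_sumset N A \<and> b \<in> A}"
  then obtain a b where a: "v = (\<Sum>i=1..N. a i) + b" "\<forall>i\<in>{1..N}. a i \<in> A" "b \<in> A"
    by (auto simp: iterated_sumset_def)
  define a' where "a' = a(Suc N := b)"
  have "(\<Sum>i=1..N. a' i) = (\<Sum>i=1..N. a i)"
    by (rule sum.cong) (auto simp: a'_def)
  then have "v = (\<Sum>i=1..Suc N. a' i)" "\<forall>i\<in>{1..Suc N}. a' i \<in> A"
    using a by (auto simp: a'_def)
  then show "v \<in> iterated_sumset (Suc N) A"
    unfolding iterated_sumset_def by blast
qed

lemma card_iterated_sumset_le:
  fixes A :: "(int ^ 'd) set"
  assumes "finite A"
  shows "\<exists>C. \<forall>N. card (iterated_sumset N A) \<le> (2 * (C * N) + 1) ^ CARD('d)"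
proof -
  define C where "C = nat (\<Sum>a\<in>A. \<Sum>k\<in>UNIV. \<bar>a $ k\<bar>)"
  have "\<bar>a $ k\<bar> \<le> (\<Sum>k\<in>UNIV. \<bar>a $ k\<bar>)" for a :: "int ^ 'd" and k
    by (rule member_le_sum) auto
  moreover have "(\<Sum>k\<in>UNIV. \<bar>a $ k\<bar>) \<le> (\<Sum>a\<in>A. \<Sum>k\<in>UNIV. \<bar>a $ k\<bar>)" if "a \<in> A" for a
    using that assms by (intro member_le_sum) (auto intro: sum_nonneg)
  ultimately have C: "\<bar>a $ k\<bar> \<le> int C" if "a \<in> A" for a k
    unfolding C_def using that by (smt (verit) nat_0_le)
  have bound: "\<bar>v $ k\<bar> \<le> int (C * N)" if "v \<in> iterated_sumset N A" for v k N
    using that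
  proof (induction N arbitrary: v)
    case 0
    then show ?case by (simp add: iterated_sumset_0)
  next
    case (Suc N)
    then obtain s b where v: "v = s + b" "s \<in> iterated_sumset N A" "b \<in> A"
      by (auto simp: iterated_sumset_Suc)
    then have "\<bar>v $ k\<bar> \<le> \<bar>s $ k\<bar> + \<bar>b $ k\<bar>"
      by simp
    with Suc.IH[OF v(2)] C[OF v(3), of k] show ?case
      by (simp add: algebra_simps)
  qed
  have "card (iterated_sumset N A) \<le> (2 * (C * N) + 1) ^ CARD('d)" for N
  proof -
    let ?B = "UNIV \<rightarrow>\<^sub>E {- int (C * N)..int (C * N)} :: ('d \<Rightarrow> int) set"
    have "card (iterated_sumset N A) \<le> card ?B"
    proof (rule card_inj_on_le)
      show "inj_on vec_nth (iterated_sumset N A)"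
        by (auto simp: inj_on_def vec_nth_inject)
      show "vec_nth ` iterated_sumset N A \<subseteq> ?B"
      proof (rule image_subsetI)
        fix v assume "v \<in> iterated_sumset N A"
        then have "- int (C * N) \<le> v $ k \<and> v $ k \<le> int (C * N)" for k
          using bound[of v N k] by (simp del: of_nat_mult add: abs_le_iff)
        then show "vec_nth v \<in> ?B"
          by (simp add: PiE_iff)
      qed
      show "finite ?B"
        by (rule finite_PiE) auto
    qed
    also have "card ?B = (2 * (C * N) + 1) ^ CARD('d)"
      by (simp add: card_funcsetE nat_add_distrib nat_mult_distrib mult.commute)
    finally show ?thesis .
  qed
  then show ?thesis by blast
qed

text \<open>
Only eventual agreement with some polynomial has to be established: the degree bound follows from the
polynomial growth of the sumsets.
\<close>

lemma khovanskii_poly_eqI: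
  fixes A :: "(int ^ 'd) set"
  assumes "finite A" and p: "\<And>N. N > T \<Longrightarrow> of_nat (card (iterated_sumset N A)) = poly p (of_nat N)"
  shows "khovanskii_poly A = p"
proof -
  obtain C where C: "\<And>N. card (iterated_sumset N A) \<le> (2 * (C * N) + 1) ^ CARD('d)"
    using card_iterated_sumset_le[OF assms(1)] by blast
  have "degree p \<le> CARD('d)"
  proof (rule degree_le_of_polynomial_growth)
    fix N :: nat assume "N > T"
    then have "poly p (of_nat N) = of_nat (card (iterated_sumset N A))"
      using p by simp
    then show "0 \<le> poly p (of_nat N)" "poly p (of_nat N) \<le> of_nat (2 * (C * N) + 1) ^ CARD('d)"
      using C[of N] by (simp_all only: of_nat_power[symmetric] of_nat_le_iff of_nat_0_le_iff)
  qed
  then have "is_khovanskii_poly A p"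
    unfolding is_khovanskii_poly_def using p by (auto intro!: exI[of _ "Suc T"])
  then show ?thesis
    unfolding khovanskii_poly_def using is_khovanskii_poly_unique by blast
qed

section \<open>Sumsets as sets of combinations\<close>

definition combination :: "nat \<Rightarrow> (nat \<Rightarrow> int ^ 'd) \<Rightarrow> (nat \<Rightarrow> nat) \<Rightarrow> int ^ 'd" where
  "combination n a x = (\<Sum>i<n. of_nat (x i) * a i)"

lemma iterated_sumset_eq_combinations:
  assumes A: "A = a ` {..<n}"
  shows "iterated_sumset N A = combination n a ` compositions n N"
proof (induction N)
  case 0
  have "compositions n 0 = {\<lambda>_. 0}"
    by (auto simp: compositions_def fun_eq_iff) (metis lessThan_iff not_le)
  then show ?case
    by (simp add: iterated_sumset_0 combination_def)
next
  case (Suc N)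
  define add where "add x k = (\<lambda>i. x i + (if i = k then 1 else 0))" for x :: "nat \<Rightarrow> nat" and k :: nat
  have comb: "combination n a (add x k) = combination n a x + a k" if "k < n" for x k
  proof -
    have "combination n a (add x k) = (\<Sum>i<n. of_nat (x i) * a i + (if i = k then a i else 0))"
      unfolding combination_def add_def by (rule sum.cong) (auto simp: algebra_simps)
    with that show ?thesis
      by (simp add: sum.distrib combination_def)
  qed
  have total: "(\<Sum>i<n. add x k i) = Suc (\<Sum>i<n. x i)" if "k < n" for x k
    using that by (simp add: add_def sum.distrib)
  show ?case
  proof (intro equalityI subsetI)
    fix v assume "v \<in> iterated_sumset (Suc N) A"
    then obtain x k where x: "x \<in> compositions n N" "k < n" "v = combination n a x + a k"
      unfolding iterated_sumset_Suc Suc.IH by (auto simp: A)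
    then have "add x k \<in> compositions n (Suc N)"
      using total[of k x] by (auto simp: compositions_def) (simp add: add_def)
    with x comb show "v \<in> combination n a ` compositions n (Suc N)"
      by (metis image_eqI)
  next
    fix v assume "v \<in> combination n a ` compositions n (Suc N)"
    then obtain z where z: "v = combination n a z" "\<forall>i\<ge>n. z i = 0" "(\<Sum>i<n. z i) = Suc N"
      by (auto simp: compositions_def)
    then obtain k where k: "k < n" "z k > 0"
      by (metis lessThan_iff nat.distinct(1) neq0_conv sum.neutral)
    define x where "x = z(k := z k - 1)"
    have zx: "z = add x k"
      using k by (auto simp: x_def add_def fun_eq_iff)
    have "x \<in> compositions n N"
      using z total[OF k(1), of x] by (auto simp: compositions_def zx[symmetric]) (simp add: x_def k)
    moreover have "v = combination n a x + a k"
      using z(1) comb[OF k(1)] zx by simp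
    ultimately show "v \<in> iterated_sumset (Suc N) A"
      unfolding iterated_sumset_Suc Suc.IH using k(1) by (auto simp: A)
  qed
qed

text \<open>
The index \<open>None\<close> records the total and \<open>Some l\<close> the coordinate $l$ of the
sum. The base point $a_0$ is subtracted so that all coefficients are bounded by the width of $A$ and not
by the size of its elements; given the total, this loses no information.
\<close>

definition homogenized :: "(nat \<Rightarrow> int ^ 'd) \<Rightarrow> 'd option \<Rightarrow> nat \<Rightarrow> int" where
  "homogenized a k i = (case k of None \<Rightarrow> 1 | Some l \<Rightarrow> (a i - a 0) $ l)"

lemma weight_homogenized_None: "weight (homogenized a) n x None = int (\<Sum>i<n. x i)"
  by (simp add: weight_def homogenized_def)

lemma weight_homogenized_Some:
  "weight (homogenized a) n x (Some k) = combination n a x $ k - int (\<Sum>i<n. x i) * a 0 $ k"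
  by (simp add: weight_def homogenized_def combination_def right_diff_distrib sum_subtractf
      sum_distrib_right of_nat_index)

lemma weight_homogenized_eq_iff:
  assumes "x \<in> compositions n N" and "\<forall>i\<ge>n. y i = 0"
  shows "weight (homogenized a) n y = weight (homogenized a) n x
    \<longleftrightarrow> y \<in> compositions n N \<and> combination n a y = combination n a x"
proof -
  have "weight (homogenized a) n y = weight (homogenized a) n x
    \<longleftrightarrow> (\<Sum>i<n. y i) = N
      \<and> (\<forall>k. weight (homogenized a) n y (Some k) = weight (homogenized a) n x (Some k))"
    using assms(1)
    by (auto simp: fun_eq_iff compositions_def weight_homogenized_None split_option_all
        simp del: of_nat_sum)
  also have "\<dots> \<longleftrightarrow> y \<in> compositions n N \<and> combination n a y = combination n a x"
    using assms by (auto simp: compositions_def weight_homogenized_Some vec_eq_iff simp del: of_nat_sum)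
  finally show ?thesis .
qed

text \<open>
Every nonempty fibre of the combination map on the finite set of vectors of total $N$ has exactly one
lexicographically minimal element, which is its only element that is not superfluous.
\<close>

lemma card_combinations:
  "card (combination n a ` compositions n N)
     = card {x \<in> compositions n N. \<not> superfluous (homogenized a) n x}"
    (is "_ = card ?R")
proof -
  have sup: "superfluous (homogenized a) n x
      \<longleftrightarrow> (\<exists>y\<in>compositions n N. less_fun y x \<and> combination n a y = combination n a x)"
    if "x \<in> compositions n N" for x
    unfolding superfluous_def using weight_homogenized_eq_iff[OF that]
    by (auto simp: compositions_def)
  have "inj_on (combination n a) ?R"
  proof (rule inj_onI)
    fix x y assume xy: "x \<in> ?R" "y \<in> ?R" "combination n a x = combination n a y"
    have "finite {i. x i \<noteq> y i}"
      by (rule finite_subset[of _ "{..<n}"])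
        (use xy in \<open>auto simp: compositions_def not_le[symmetric]\<close>)
    with xy show "x = y"
      using less_fun_trichotomy[of x y] sup by auto
  qed
  moreover have "combination n a ` ?R = combination n a ` compositions n N"
  proof (intro equalityI image_subsetI)
    fix x assume x: "x \<in> compositions n N"
    interpret lex: order "\<lambda>f g :: nat \<Rightarrow> nat. less_fun f g \<or> f = g" less_fun
      by (rule order_less_fun)
    let ?F = "{y \<in> compositions n N. combination n a y = combination n a x}"
    have "finite ?F" "?F \<noteq> {}"
      using x finite_compositions[of n N] by auto
    from lex.finite_has_minimal[OF this] obtain m
      where m: "m \<in> ?F" "\<And>y. y \<in> ?F \<Longrightarrow> \<not> less_fun y m"
      using less_fun_irrefl by blast
    then have "m \<in> ?R"
      using sup[of m] by auto
    with m(1) show "combination n a x \<in> combination n a ` ?R"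
      by (metis (mono_tags, lifting) image_eqI mem_Collect_eq)
  qed auto
  ultimately show ?thesis
    by (metis card_image)
qed

section \<open>The explicit threshold\<close>

text \<open>
The constraint ``equal totals'' has coefficients $1$, which is why the common bound $W$ of all
coefficients has to be at least $1$.
\<close>

theorem card_iterated_sumset_eventually_polynomial:
  fixes A :: "(int ^ 'd) set"
  assumes "finite A" and W: "\<And>a b k. a \<in> A \<Longrightarrow> b \<in> A \<Longrightarrow> \<bar>(a - b) $ k\<bar> \<le> int W" and "W \<ge> 1"
    and N: "N > card A * (2 * (card A * W) + 1) ^ (CARD('d) + 1)"
  shows "of_nat (card (iterated_sumset N A)) = poly (khovanskii_poly A) (of_nat N)"
proof -
  define n where "n = card A"
  define M where "M = (2 * (n * W) + 1) ^ (CARD('d) + 1)"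
  obtain a where a: "bij_betw a {0..<n} A"
    using ex_bij_betw_nat_finite[OF assms(1)] n_def by blast
  then have A: "A = a ` {..<n}"
    by (simp add: bij_betw_def lessThan_atLeast0)
  have M: "M = (2 * (n * W) + 1) ^ CARD('d option)"
    by (simp add: M_def)
  have "\<bar>homogenized a k i\<bar> \<le> int W" if "i < n" for k i
    using W[of "a i" "a 0"] that A \<open>W \<ge> 1\<close> by (auto simp: homogenized_def split: option.split)
  then have "superfluous (homogenized a) n x
      \<longleftrightarrow> superfluous (homogenized a) n (\<lambda>i. min (x i) M)" if "\<forall>i\<ge>n. x i = 0" for x
    unfolding M using that by (intro superfluous_iff_truncation)
  then obtain p :: "rat poly" where p: "\<And>N. N > n * M \<Longrightarrow>
      of_nat (card {x \<in> compositions n N. \<not> superfluous (homogenized a) n x}) = poly p (of_nat N)"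
    using card_compositions_polynomial[of n "\<lambda>x. \<not> superfluous (homogenized a) n x" M] by blast
  then have p: "of_nat (card (iterated_sumset N A)) = poly p (of_nat N)" if "N > n * M" for N
    using that by (simp add: iterated_sumset_eq_combinations[OF A] card_combinations)
  have "khovanskii_poly A = p"
    using p by (rule khovanskii_poly_eqI[OF assms(1)])
  then show ?thesis
    using p N by (simp add: n_def M_def)
qed

lemma iterated_sumset_singleton: "iterated_sumset N {a} = {of_nat N * a}"
  by (induction N) (simp_all add: iterated_sumset_0 iterated_sumset_Suc algebra_simps)

lemma abs_nth_le_linf_norm: "\<bar>x $ k\<bar> \<le> linf_norm x"
proof -
  have "{\<bar>x $ i\<bar> | i. i \<in> UNIV} = range (\<lambda>i. \<bar>x $ i\<bar>)"
    by auto
  then show ?thesis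
    by (simp add: linf_norm_def)
qed

lemma linf_norm_diff_le_width:
  assumes "finite A" and "a \<in> A" and "b \<in> A"
  shows "linf_norm (a - b) \<le> width A"
proof -
  have "{linf_norm (a1 - a2) | a1 a2. a1 \<in> A \<and> a2 \<in> A}
      = (\<lambda>(a1, a2). linf_norm (a1 - a2)) ` (A \<times> A)"
    by auto
  with assms show ?thesis
    by (auto simp: width_def intro!: Max_ge)
qed

text \<open>
With $K = 2nW \ge 4$ one has $n < K$ and $2nW + 1 \le K^2$, so the left-hand side is less than
$K^{2d+3}$.
\<close>

lemma threshold_comparison:
  fixes n W d :: nat
  assumes "n \<ge> 2" and "W \<ge> 1"
  shows "n * (2 * (n * W) + 1) ^ (d + 1) < (2 * n * W) ^ ((d + 4) * n)"
proof -
  let ?K = "2 * n * W"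
  have K: "?K \<ge> 4"
    using mult_le_mono[OF assms] by (simp add: mult.commute)
  have "n < ?K"
    using assms mult_le_mono2[OF assms(2), of n] by simp
  moreover have "2 * (n * W) + 1 \<le> ?K ^ 2"
  proof -
    have "2 * (n * W) + 1 \<le> 4 * ?K"
      using assms by simp
    also have "\<dots> \<le> ?K * ?K"
      using K by (rule mult_le_mono1)
    finally show ?thesis
      by (simp add: power2_eq_square)
  qed
  then have "(2 * (n * W) + 1) ^ (d + 1) \<le> (?K ^ 2) ^ (d + 1)"
    by (rule power_mono) simp
  ultimately have "n * (2 * (n * W) + 1) ^ (d + 1) < ?K * (?K ^ 2) ^ (d + 1)"
    using assms by (intro mult_less_le_imp_less) auto
  also have "\<dots> = ?K ^ (2 * d + 3)"
    by (simp add: power_mult[symmetric] power_Suc[symmetric] del: power_Suc) (simp add: numeral_eq_Suc)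
  also have "\<dots> \<le> ?K ^ ((d + 4) * n)"
  proof (rule power_increasing)
    have "2 * d + 3 \<le> (d + 4) * 2"
      by simp
    also have "\<dots> \<le> (d + 4) * n"
      using assms(1) by (rule mult_le_mono2)
    finally show "2 * d + 3 \<le> (d + 4) * n" .
  qed (use assms in simp)
  finally show ?thesis .
qed

theorem theorem1p1:
  fixes A :: "(int ^ 'd) set" and N :: nat
  assumes "finite A" and "A \<noteq> {}"
    and "N \<ge> 1"
    and "int N \<ge> (2 * int (card A) * width A) ^ ((CARD('d) + 4) * card A)"
  shows "of_nat (card (iterated_sumset N A)) = poly (khovanskii_poly A) (of_nat N)"
proof (cases "card A = 1")
  case True
  then obtain a where A: "A = {a}"
    by (auto simp: card_1_singleton_iff)
  have "khovanskii_poly A = 1"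
    by (rule khovanskii_poly_eqI) (simp_all add: A iterated_sumset_singleton)
  then show ?thesis
    by (simp add: A iterated_sumset_singleton)
next
  case False
  with assms(1,2) have n: "card A \<ge> 2"
    by (metis One_nat_def Suc_1 Suc_leI card_gt_0_iff le_neq_implies_less)
  then obtain a b where ab: "a \<in> A" "b \<in> A" "a \<noteq> b"
    by (metis assms(2) card_1_singleton_iff False is_singletonI' is_singleton_altdef)
  then obtain k where "a $ k \<noteq> b $ k"
    by (auto simp: vec_eq_iff)
  then have "1 \<le> \<bar>(a - b) $ k\<bar>"
    by simp
  then have width: "width A \<ge> 1"
    using abs_nth_le_linf_norm[of "a - b" k] linf_norm_diff_le_width[OF assms(1) ab(1,2)] by linarith
  define W where "W = nat (width A)"
  have W: "width A = int W" "W \<ge> 1"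
    using width by (auto simp: W_def)
  have "int N \<ge> int ((2 * card A * W) ^ ((CARD('d) + 4) * card A))"
    using assms(4) W(1) by simp
  then have N: "N > card A * (2 * (card A * W) + 1) ^ (CARD('d) + 1)"
    using threshold_comparison[OF n W(2), of "CARD('d)"] by linarith
  show ?thesis
  proof (rule card_iterated_sumset_eventually_polynomial[OF assms(1) _ W(2) N])
    fix a b k assume "a \<in> A" "b \<in> A"
    then show "\<bar>(a - b) $ k\<bar> \<le> int W"
      using abs_nth_le_linf_norm[of "a - b" k] linf_norm_diff_le_width[OF assms(1)] W(1)
      by (metis order_trans)
  qed
qed

end
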